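(* Let $N\ge 2$ and $n\ge 1$. Suppose the $N\times N$ real matrix $A=(a_{ij})$ satisfies $A\in\mathbf{A2}$ and is irreducible. Let $f:\mathbb{R}^n\times[0,\infty)\to\mathbb{R}^n$ be continuous with $f\in QUAD(\Delta,\varpi)$ for some real diagonal matrix $\Delta=\mathrm{diag}(\delta_1,\dots,\delta_n)$ and some $\varpi>0$. Let $g_1,\dots,g_n:\mathbb{R}\to\mathbb{R}$ be functions for which there is a constant $\beta>0$ with $\frac{g_k(u)-g_k(v)}{u-v}\ge\beta$ for all $u\ne v$ and $k=1,\dots,n$. Let $\alpha>0$. Consider the nonlinearly coupled system with adaptive coupling strength $$\dot X(t)=F(X(t))+c(t)\,(A\otimes I_n)G(X(t)),\qquad \dot c(t)=-\frac{\alpha}{2}X^T(t)\,(A\otimes I_n)G(X(t)),\qquad c(0)=0,$$ where $X(t)=(x_1^T(t),\dots,x_N^T(t))^T$ with $x_i(t)=(x_i^1(t),\dots,x_i^n(t))^T\in\mathbb{R}^n$, $F(X(t))=(f(x_1(t),t)^T,\dots,f(x_N(t),t)^T)^T$, $g(x_i)=(g_1(x_i^1),\dots,g_n(x_i^n))^T$ and $G(X(t))=(g(x_1(t))^T,\dots,g(x_N(t))^T)^T$. Then the system will be synchronized: for every initial value $X(0)\in\mathbb{R}^{nN}$ and every solution $(X,c)$ on $[0,\infty)$ with that initial value and $c(0)=0$, one has $\lim_{t\to\infty}\|x_i(t)-x_j(t)\|=0$ for all $i,j=1,\dots,N$.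
   Context: A matrix $A=(a_{ij})_{i,j=1}^N$ satisfies Condition $\mathbf{A1}$ if (1) $a_{ij}\ge 0$ for $i\ne j$ and $a_{ii}=-\sum_{j\neq i}a_{ij}$ for all $i$; (2) all eigenvalues of $A$ have negative real part except the eigenvalue $0$, which has multiplicity $1$. $A\in\mathbf{A2}$ means $A\in\mathbf{A1}$ and $a_{ij}=a_{ji}$ for all $i\ne j$ (so its eigenvalues are real). For a real diagonal matrix $\Delta=\mathrm{diag}(\delta_1,\dots,\delta_n)$ and $\varpi>0$, $f\in QUAD(\Delta,\varpi)$ means that $(x-y)^T[f(x,t)-f(y,t)]-(x-y)^T\Delta(x-y)\le-\varpi(x-y)^T(x-y)$ for all $x,y\in\mathbb{R}^n$ and all $t\ge 0$. $\otimes$ is the Kronecker product and $I_n$ the $n\times n$ identity matrix; $\|\cdot\|$ is any norm on $\mathbb{R}^n$. *)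

theory Defs
  imports "HOL-Analysis.Analysis" "HOL-Computational_Algebra.Polynomial"
begin

definition char_poly :: "'a::comm_ring_1^'n^'n \<Rightarrow> 'a poly" where
  "char_poly A = det (\<chi> i j. (if i = j then [:0, 1:] else 0) - [:A $ i $ j:])"

definition eigenvalue :: "'a::field^'n^'n \<Rightarrow> 'a \<Rightarrow> bool" where
  "eigenvalue A l \<longleftrightarrow> (\<exists>v. v \<noteq> 0 \<and> A *v v = l *s v)"

definition complex_mat :: "real^'n^'m \<Rightarrow> complex^'n^'m" where
  "complex_mat A = (\<chi> i j. complex_of_real (A $ i $ j))"

(* Multiplicity is algebraic: the order of 0 as a root of the characteristic polynomial. *)
definition A1 :: "real^'N^'N \<Rightarrow> bool" where
  "A1 A \<longleftrightarrow>
     (\<forall>i j. i \<noteq> j \<longrightarrow> A $ i $ j \<ge> 0) \<and>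
     (\<forall>i. A $ i $ i = - (\<Sum>j\<in>UNIV - {i}. A $ i $ j)) \<and>
     (\<forall>l. eigenvalue (complex_mat A) l \<and> l \<noteq> 0 \<longrightarrow> Re l < 0) \<and>
     eigenvalue (complex_mat A) 0 \<and>
     order 0 (char_poly (complex_mat A)) = 1"

definition A2 :: "real^'N^'N \<Rightarrow> bool" where
  "A2 A \<longleftrightarrow> A1 A \<and> (\<forall>i j. i \<noteq> j \<longrightarrow> A $ i $ j = A $ j $ i)"

(* No simultaneous permutation of rows and columns brings A to block triangular form
   with square diagonal blocks; S and - S are the index sets of the two blocks. *)
definition irreducible_mat :: "'a::zero^'N^'N \<Rightarrow> bool" where
  "irreducible_mat A \<longleftrightarrow>
     \<not> (\<exists>S. S \<noteq> {} \<and> S \<noteq> UNIV \<and> (\<forall>i\<in>S. \<forall>j\<in>- S. A $ i $ j = 0))"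

definition diag_mat :: "'a::zero^'n \<Rightarrow> 'a^'n^'n" where
  "diag_mat d = (\<chi> i j. if i = j then d $ i else 0)"

definition QUAD :: "real^'n^'n \<Rightarrow> real \<Rightarrow> (real^'n \<Rightarrow> real \<Rightarrow> real^'n) \<Rightarrow> bool" where
  "QUAD \<Delta> \<omega> f \<longleftrightarrow>
     (\<forall>x y. \<forall>t\<ge>0. (x - y) \<bullet> (f x t - f y t) - (x - y) \<bullet> (\<Delta> *v (x - y))
        \<le> - \<omega> * ((x - y) \<bullet> (x - y)))"

definition kronecker :: "'a::times^'n^'m \<Rightarrow> 'a^'q^'p \<Rightarrow> 'a^('n::finite \<times> 'q::finite)^('m::finite \<times> 'p::finite)"  (infixl "\<otimes>\<^sub>K" 75) where
  "A \<otimes>\<^sub>K B = (\<chi> r s. A $ fst r $ fst s * B $ snd r $ snd s)"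

(* A stacked vector in R^(nN) is indexed by pairs (node, component);
   block X i is the state x_i of node i. *)
definition block :: "'a^('N::finite \<times> 'n::finite) \<Rightarrow> 'N \<Rightarrow> 'a^'n" where
  "block X i = (\<chi> k. X $ (i, k))"

definition stack :: "('N \<Rightarrow> 'a^'n) \<Rightarrow> 'a^('N::finite \<times> 'n::finite)" where
  "stack x = (\<chi> p. x (fst p) $ snd p)"

definition F_net :: "(real^'n \<Rightarrow> real \<Rightarrow> real^'n) \<Rightarrow> real \<Rightarrow> real^('N::finite \<times> 'n::finite) \<Rightarrow> real^('N::finite \<times> 'n::finite)" where
  "F_net f t X = stack (\<lambda>i. f (block X i) t)"

definition G_net :: "('n \<Rightarrow> real \<Rightarrow> real) \<Rightarrow> real^('N::finite \<times> 'n::finite) \<Rightarrow> real^('N::finite \<times> 'n::finite)" where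
  "G_net g X = stack (\<lambda>i. \<chi> k. g k (block X i $ k))"

(* At t = 0 the derivatives are one-sided. *)
definition adaptive_solution ::
  "real^'N^'N \<Rightarrow> (real^'n \<Rightarrow> real \<Rightarrow> real^'n) \<Rightarrow> ('n \<Rightarrow> real \<Rightarrow> real) \<Rightarrow> real \<Rightarrow>
   (real \<Rightarrow> real^('N::finite \<times> 'n::finite)) \<Rightarrow> (real \<Rightarrow> real) \<Rightarrow> bool" where
  "adaptive_solution A f g \<alpha> X c \<longleftrightarrow>
     (\<forall>t\<ge>0.
        (X has_vector_derivative
           F_net f t (X t) + c t *\<^sub>R ((A \<otimes>\<^sub>K mat 1) *v G_net g (X t))) (at t within {0..}) \<and>
        (c has_real_derivative
           - (\<alpha> / 2) * (X t \<bullet> ((A \<otimes>\<^sub>K mat 1) *v G_net g (X t)))) (at t within {0..})) \<and>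
     c 0 = 0"

definition is_norm :: "('a::real_vector \<Rightarrow> real) \<Rightarrow> bool" where
  "is_norm \<nu> \<longleftrightarrow>
     (\<forall>x. 0 \<le> \<nu> x) \<and> (\<forall>x. \<nu> x = 0 \<longleftrightarrow> x = 0) \<and>
     (\<forall>a x. \<nu> (a *\<^sub>R x) = \<bar>a\<bar> * \<nu> x) \<and> (\<forall>x y. \<nu> (x + y) \<le> \<nu> x + \<nu> y)"

end

(* Let W be the sum of the squared distances of the nodes to their mean. By Condition A2 and the
   strong monotonicity of g, the gain satisfies c' >= kappa W with kappa > 0, where irreducibility
   and compactness of the unit sphere of sum-zero vectors give kappa; the QUAD condition gives
   W' <= K W - gamma c c'. If c gets above (K + 1) / (gamma kappa), W decays exponentially from then on.
   Otherwise c converges, being increasing and bounded, and since W grows at most at rate |K|,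
   the increment c t - c (t - 1), which tends to 0, dominates a multiple of W t. *)
theory Submission
  imports Defs "HOL-Real_Asymp.Real_Asymp"
begin

section \<open>Scalar differential inequalities\<close>

lemma DERIV_atLeast_imp_at:
  assumes "(f has_real_derivative D) (at t within {a..})" "a < t"
  shows "DERIV f t :> D"
proof -
  have "at t within {a..} = at t"
    using \<open>a < t\<close> by (intro at_within_open_subset[of _ "{a<..}"]) auto
  with assms(1) show ?thesis by simp
qed

text \<open>The integrating factor \<open>exp (- k * t)\<close> makes the product with
  \<open>W\<close> nonincreasing on \<open>{r..s}\<close>. Both signs of the rate are used later:
  \<open>- 1\<close> for decay, \<open>\<bar>K\<bar>\<close> to limit growth over a short
  interval.\<close>

lemma derivative_le_imp_exp_bound:
  fixes W W' :: "real \<Rightarrow> real"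
  assumes deriv: "\<And>t. 0 \<le> t \<Longrightarrow> (W has_real_derivative W' t) (at t within {0..})"
    and le: "\<And>t. r \<le> t \<Longrightarrow> t \<le> s \<Longrightarrow> W' t \<le> k * W t"
    and "0 \<le> r" "r \<le> s"
  shows "W s \<le> exp (k * (s - r)) * W r"
proof -
  have cont: "continuous_on {r..s} W"
    using \<open>0 \<le> r\<close> by (intro DERIV_continuous_on[where D = W'] DERIV_subset[OF deriv]) auto
  have "exp (- k * s) * W s \<le> exp (- k * r) * W r"
  proof (rule DERIV_nonpos_imp_decreasing_open[OF \<open>r \<le> s\<close>])
    fix t assume t: "r < t" "t < s"
    then have "DERIV W t :> W' t"
      using \<open>0 \<le> r\<close> by (intro DERIV_atLeast_imp_at[OF deriv]) auto
    then have "DERIV (\<lambda>t. exp (- k * t) * W t) t :> exp (- k * t) * (W' t - k * W t)"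
      by (auto intro!: derivative_eq_intros simp: algebra_simps)
    moreover have "exp (- k * t) * (W' t - k * W t) \<le> 0"
      using le[of t] t by (simp add: mult_nonneg_nonpos)
    ultimately show "\<exists>y. DERIV (\<lambda>t. exp (- k * t) * W t) t :> y \<and> y \<le> 0"
      by blast
  qed (intro continuous_intros cont)
  then have "exp (k * s) * (exp (- k * s) * W s) \<le> exp (k * s) * (exp (- k * r) * W r)"
    by simp
  then show ?thesis
    by (simp only: mult.assoc[symmetric] exp_add[symmetric]) (simp add: right_diff_distrib)
qed

text \<open>This isolates the scalar part of the argument, with \<open>W\<close> as disagreement and
  \<open>c\<close> as gain. The dissipation is expressed through \<open>c'\<close> itself, so the
  lower bound on \<open>c'\<close> turns it into damping proportional to
  \<open>c t * W t\<close>.\<close>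

lemma adaptive_gain_tendsto_zero:
  fixes W W' c c' :: "real \<Rightarrow> real"
  assumes W: "\<And>t. 0 \<le> t \<Longrightarrow> (W has_real_derivative W' t) (at t within {0..})"
    and c: "\<And>t. 0 \<le> t \<Longrightarrow> (c has_real_derivative c' t) (at t within {0..})"
    and nonneg: "\<And>t. 0 \<le> t \<Longrightarrow> 0 \<le> W t" and "0 \<le> c 0"
    and "0 < \<kappa>" "0 < \<gamma>"
    and c': "\<And>t. 0 \<le> t \<Longrightarrow> \<kappa> * W t \<le> c' t"
    and W': "\<And>t. 0 \<le> t \<Longrightarrow> W' t \<le> K * W t - \<gamma> * c t * c' t"
  shows "(W \<longlongrightarrow> 0) at_top"
proof -
  have c'_nonneg: "0 \<le> c' t" if "0 \<le> t" for t
    using order_trans[OF mult_nonneg_nonneg c'[OF that]] nonneg[OF that] \<open>0 < \<kappa>\<close> by simp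
  have cont: "continuous_on {r..s} c" if "0 \<le> r" for r s
    using that by (intro DERIV_continuous_on[where D = c'] DERIV_subset[OF c]) auto
  have mono: "c r \<le> c s" if "0 \<le> r" "r \<le> s" for r s
  proof (rule DERIV_nonneg_imp_increasing_open[OF \<open>r \<le> s\<close>])
    fix t assume t: "r < t" "t < s"
    with that have "DERIV c t :> c' t"
      by (intro DERIV_atLeast_imp_at[OF c]) auto
    with t that c'_nonneg[of t] show "\<exists>y. DERIV c t :> y \<and> 0 \<le> y"
      by auto
  qed (use cont that in auto)
  \<comment> \<open>Replacing \<open>c'\<close> by its lower bound is legitimate because
    \<open>c\<close> increases from a nonnegative start, so its factor \<open>\<gamma> * c t\<close>
    is nonnegative.\<close>
  have W'_le: "W' t \<le> (K - \<gamma> * \<kappa> * c t) * W t" if "0 \<le> t" for t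
  proof -
    have "0 \<le> \<gamma> * c t"
      using mono[of 0 t] \<open>0 \<le> c 0\<close> \<open>0 < \<gamma>\<close> that by simp
    from mult_left_mono[OF c'[OF that] this] W'[OF that] show ?thesis
      by (simp add: algebra_simps)
  qed
  show ?thesis
  \<comment> \<open>At this threshold the coefficient \<open>K - \<gamma> * \<kappa> * c T\<close>
    is at most \<open>- 1\<close>, and monotonicity of \<open>c\<close> keeps it there for all later
    times.\<close>
  proof (cases "\<exists>T\<ge>0. K + 1 \<le> \<gamma> * \<kappa> * c T")
    case True
    then obtain T where T: "0 \<le> T" "K + 1 \<le> \<gamma> * \<kappa> * c T" by blast
    have "W t \<le> exp (- 1 * (t - T)) * W T" if "T \<le> t" for t
    proof (rule derivative_le_imp_exp_bound[OF W _ _ that])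
      fix s assume s: "T \<le> s" "s \<le> t"
      have "\<gamma> * \<kappa> * c T \<le> \<gamma> * \<kappa> * c s"
        using mono[of T s] T s \<open>0 < \<kappa>\<close> \<open>0 < \<gamma>\<close> by simp
      then have "(K - \<gamma> * \<kappa> * c s) * W s \<le> - 1 * W s"
        using T s by (intro mult_right_mono nonneg) auto
      then show "W' s \<le> - 1 * W s"
        using W'_le[of s] T s by simp
    qed (use T in auto)
    then have upper: "\<forall>\<^sub>F t in at_top. W t \<le> exp (- 1 * (t - T)) * W T"
      by (rule eventually_mono[OF eventually_ge_at_top[of T]])
    have lower: "\<forall>\<^sub>F t in at_top. 0 \<le> W t"
      using eventually_mono[OF eventually_ge_at_top[of 0] nonneg] .
    have lim: "((\<lambda>t. exp (- 1 * (t - T)) * W T) \<longlongrightarrow> 0) at_top"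
      by (rule tendsto_mult_left_zero) real_asymp
    show ?thesis
      by (rule tendsto_sandwich[OF lower upper tendsto_const lim])
  next
    case False
    define B where "B = (K + 1) / (\<gamma> * \<kappa>)"
    have B: "c t \<le> B" if "0 \<le> t" for t
    proof -
      have "\<gamma> * \<kappa> * c t < K + 1"
        using False that by force
      then show ?thesis
        using \<open>0 < \<kappa>\<close> \<open>0 < \<gamma>\<close> by (simp add: B_def pos_le_divide_eq mult.commute)
    qed
    then have bdd: "bdd_above (c ` {0..})"
      by (auto intro!: bdd_aboveI)
    \<comment> \<open>Over a time span of at most 1, \<open>W\<close> grows at most by the factor
      \<open>exp \<bar>K\<bar>\<close>; \<open>q\<close> is \<open>\<kappa>\<close> divided by that
      factor.\<close>
    define q where "q = \<kappa> * exp (- \<bar>K\<bar>)"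
    have "0 < q" using \<open>0 < \<kappa>\<close> by (simp add: q_def)
    \<comment> \<open>The mean value theorem yields \<open>z\<close> in the last unit interval with
      increment \<open>c' z\<close>, which is at least \<open>\<kappa> * W z\<close>. The hypotheses
      bound \<open>W'\<close> only from above, so \<open>W t\<close> is compared with the earlier
      value \<open>W z\<close>.\<close>
    have increment: "q * W t \<le> c t - c (t - 1)" if "1 \<le> t" for t
    proof -
      have c_at: "(c has_derivative (\<lambda>v. c' z * v)) (at z)" if "t - 1 < z" for z
        using DERIV_atLeast_imp_at[OF c, of z] that \<open>1 \<le> t\<close>
        by (simp add: has_field_derivative_def)
      obtain z where z: "t - 1 < z" "z < t" "c t - c (t - 1) = c' z"
      proof (rule mvt[of "t - 1" t c "\<lambda>z v. c' z * v"])
        show "continuous_on {t - 1..t} c" using cont \<open>1 \<le> t\<close> by simp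
      qed (simp_all add: c_at)
      have "W t \<le> exp (\<bar>K\<bar> * (t - z)) * W z"
      proof (rule derivative_le_imp_exp_bound[OF W])
        fix s assume s: "z \<le> s" "s \<le> t"
        then have "0 \<le> s" using z that by simp
        moreover have "0 \<le> \<gamma> * \<kappa> * c s"
          using mono[of 0 s] \<open>0 \<le> c 0\<close> \<open>0 < \<gamma>\<close> \<open>0 < \<kappa>\<close> \<open>0 \<le> s\<close> by simp
        then have "(K - \<gamma> * \<kappa> * c s) * W s \<le> \<bar>K\<bar> * W s"
          using nonneg \<open>0 \<le> s\<close> by (intro mult_right_mono) auto
        ultimately show "W' s \<le> \<bar>K\<bar> * W s"
          using W'_le[of s] by simp
      qed (use z that in auto)
      also have "\<dots> \<le> exp \<bar>K\<bar> * W z"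
        using z that mult_left_le[of "t - z" "\<bar>K\<bar>"] by (intro mult_right_mono nonneg) simp_all
      finally have "q * W t \<le> q * (exp \<bar>K\<bar> * W z)"
        using \<open>0 < q\<close> by simp
      also have "\<dots> = \<kappa> * W z"
        by (simp add: q_def exp_minus)
      finally show ?thesis
        using c'[of z] z that by simp
    qed
    show ?thesis
    proof (rule tendstoI)
      fix e :: real assume "0 < e"
      \<comment> \<open>Once \<open>c\<close> is within \<open>q * e\<close> of its supremum, all
        later increments are smaller than \<open>q * e\<close>. Starting at \<open>T + 1\<close>
        ensures that \<open>t - 1\<close> is also past \<open>T\<close>.\<close>
      have "(SUP t\<in>{0..}. c t) - q * e < (SUP t\<in>{0..}. c t)"
        using \<open>0 < q\<close> \<open>0 < e\<close> by simp
      then obtain T where T: "0 \<le> T" "(SUP t\<in>{0..}. c t) - q * e < c T"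
        using less_cSUP_iff[OF _ bdd] by auto
      have "dist (W t) 0 < e" if "T + 1 \<le> t" for t
      proof -
        have "c t \<le> (SUP t\<in>{0..}. c t)"
          using T that by (intro cSUP_upper bdd) auto
        moreover have "c T \<le> c (t - 1)"
          using mono T that by simp
        ultimately have "q * W t < q * e"
          using increment[of t] T that by simp
        then show ?thesis
          using nonneg[of t] T that \<open>0 < q\<close> by simp
      qed
      then show "\<forall>\<^sub>F t in at_top. dist (W t) 0 < e"
        by (auto simp: eventually_at_top_linorder)
    qed
  qed
qed

section \<open>Quadratic forms of the coupling matrix\<close>

text \<open>The form vanishes only on constant vectors, and the only constant vector with sum zero
  is 0. Its minimum on the compact set of sum-zero unit vectors is therefore positive, and
  homogeneity of degree 2 extends the bound to all sum-zero vectors.\<close>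

lemma irreducible_spectral_gap:
  fixes A :: "real^'N^'N"
  assumes nonneg: "\<And>i j. i \<noteq> j \<Longrightarrow> 0 \<le> A $ i $ j" and irr: "irreducible_mat A"
  obtains m where "0 < m"
    "\<And>v :: real^'N. (\<Sum>i\<in>UNIV. v $ i) = 0 \<Longrightarrow>
       m * (v \<bullet> v) \<le> (\<Sum>i\<in>UNIV. \<Sum>j\<in>UNIV. A $ i $ j * (v $ i - v $ j)\<^sup>2)"
proof -
  define Q where "Q v = (\<Sum>i\<in>UNIV. \<Sum>j\<in>UNIV. A $ i $ j * (v $ i - v $ j)\<^sup>2)" for v :: "real^'N"
  define S where "S = {v :: real^'N. (\<Sum>i\<in>UNIV. v $ i) = 0} \<inter> sphere 0 1"
  have term_nonneg: "0 \<le> A $ i $ j * (v $ i - v $ j)\<^sup>2" for i j and v :: "real^'N"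
    using nonneg[of i j] by (cases "i = j") auto
  have Q_pos: "0 < Q v" if "(\<Sum>i\<in>UNIV. v $ i) = 0" "v \<noteq> 0" for v
  proof (rule ccontr)
    assume "\<not> 0 < Q v"
    moreover have "0 \<le> Q v"
      unfolding Q_def by (intro sum_nonneg term_nonneg)
    ultimately have "Q v = 0" by simp
    then have zero: "A $ i $ j * (v $ i - v $ j)\<^sup>2 = 0" for i j
      unfolding Q_def by (simp add: sum_nonneg_eq_0_iff sum_nonneg term_nonneg)
    have const: "v $ j = v $ i" for i j
    proof -
      \<comment> \<open>No nonzero entry leads out of the level set of \<open>v\<close> through
        \<open>i\<close>. This set is nonempty, so irreducibility makes it the whole index
        set.\<close>
      have "A $ k $ l = 0" if "v $ k = v $ i" "v $ l \<noteq> v $ i" for k l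
        using zero[of k l] that by auto
      then have "{j. v $ j = v $ i} = UNIV"
        using irr unfolding irreducible_mat_def
        by (metis (mono_tags, lifting) ComplD empty_iff mem_Collect_eq)
      then show ?thesis by auto
    qed
    have "real CARD('N) * v $ i = 0" for i
    proof -
      have "(\<Sum>j\<in>UNIV. v $ j) = (\<Sum>j\<in>(UNIV :: 'N set). v $ i)"
        by (intro sum.cong refl const)
      with that(1) show ?thesis by simp
    qed
    then have "v = 0" by (simp add: vec_eq_iff)
    with that show False by simp
  qed
  have "compact S"
    unfolding S_def by (intro closed_Int_compact closed_Collect_eq continuous_intros compact_sphere)
  have "continuous_on S Q"
    unfolding Q_def by (intro continuous_intros)
  obtain m where m: "0 < m" "\<And>v. v \<in> S \<Longrightarrow> m \<le> Q v"
  proof (cases "S = {}")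
    case True
    \<comment> \<open>\<open>S\<close> is empty over a one-element index type; any positive constant
      then serves.\<close>
    then show thesis using that[of 1] by simp
  next
    case False
    then obtain v where v: "v \<in> S" "\<And>w. w \<in> S \<Longrightarrow> Q v \<le> Q w"
      using continuous_attains_inf[OF \<open>compact S\<close> _ \<open>continuous_on S Q\<close>] by blast
    moreover have "0 < Q v"
      using v(1) by (intro Q_pos) (auto simp: S_def)
    ultimately show thesis using that by blast
  qed
  have "m * (v \<bullet> v) \<le> Q v" if "(\<Sum>i\<in>UNIV. v $ i) = 0" for v
  proof (cases "v = 0")
    case False
    define w where "w = (1 / norm v) *\<^sub>R v"
    have "w \<in> S"
      using that False by (simp add: S_def w_def sum_divide_distrib[symmetric])
    have v: "v = norm v *\<^sub>R w"
      using False by (simp add: w_def)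
    have "Q v = (norm v)\<^sup>2 * Q w"
      by (subst v, simp add: Q_def sum_distrib_left power_mult_distrib
          right_diff_distrib[symmetric] mult_ac)
    then show ?thesis
      using mult_left_mono[OF m(2)[OF \<open>w \<in> S\<close>], of "(norm v)\<^sup>2"]
      by (simp add: power2_norm_eq_inner[symmetric] mult.commute)
  qed (simp add: Q_def)
  with that m(1) show thesis unfolding Q_def by blast
qed

text \<open>This is summation by parts for a graph Laplacian. Of the four double sums in the
  expanded product, the two with equal indices vanish since rows, and by symmetry columns, sum to
  zero; the two mixed ones coincide by symmetry. Allowing \<open>y\<close> to differ from
  \<open>x\<close> accommodates the nonlinear coupling.\<close>

lemma laplacian_inner_eq:
  fixes A :: "real^'N^'N" and x y :: "'N \<Rightarrow> 'a::real_inner"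
  assumes sym: "\<And>i j. A $ i $ j = A $ j $ i"
    and row: "\<And>i. (\<Sum>j\<in>UNIV. A $ i $ j) = 0"
  shows "(\<Sum>i\<in>UNIV. x i \<bullet> (\<Sum>j\<in>UNIV. A $ i $ j *\<^sub>R y j)) =
    - (\<Sum>i\<in>UNIV. \<Sum>j\<in>UNIV. A $ i $ j * ((x i - x j) \<bullet> (y i - y j))) / 2"
proof -
  define M where "M = (\<Sum>i\<in>UNIV. \<Sum>j\<in>UNIV. A $ i $ j * (x i \<bullet> y j))"
  have 1: "(\<Sum>i\<in>UNIV. \<Sum>j\<in>UNIV. A $ i $ j * (x i \<bullet> y i)) = 0"
    by (simp add: sum_distrib_right[symmetric] row)
  have 2: "(\<Sum>i\<in>UNIV. \<Sum>j\<in>UNIV. A $ i $ j * (x j \<bullet> y j)) = 0"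
    by (subst sum.swap, subst sym) (rule 1)
  have 3: "(\<Sum>i\<in>UNIV. \<Sum>j\<in>UNIV. A $ i $ j * (x j \<bullet> y i)) = M"
    unfolding M_def by (subst sum.swap, subst sym) (rule refl)
  have "(\<Sum>i\<in>UNIV. \<Sum>j\<in>UNIV. A $ i $ j * ((x i - x j) \<bullet> (y i - y j))) = - 2 * M"
    using 1 2 3 by (simp add: inner_diff_left inner_diff_right right_diff_distrib
        sum_subtractf M_def[symmetric])
  then show ?thesis
    by (simp add: M_def inner_sum_right)
qed

section \<open>Norms, stacked vectors and the QUAD condition\<close>

text \<open>Expansion in the standard basis and the triangle inequality give this half of the
  equivalence of norms, which transfers convergence to 0 from the Euclidean norm to
  \<open>\<nu>\<close>.\<close>

lemma is_norm_le_norm: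
  fixes \<nu> :: "real^'n \<Rightarrow> real"
  assumes "is_norm \<nu>"
  shows "\<nu> v \<le> (\<Sum>k\<in>UNIV. \<nu> (axis k 1)) * norm v"
proof -
  have zero: "\<nu> 0 = 0"
    using assms by (simp add: is_norm_def)
  have tri: "\<nu> (\<Sum>k\<in>I. u k) \<le> (\<Sum>k\<in>I. \<nu> (u k))" for I and u :: "'n \<Rightarrow> real^'n"
  proof (induction I rule: infinite_finite_induct)
    case (insert k I)
    then show ?case
      using assms unfolding is_norm_def by (smt (verit) sum.insert)
  qed (simp_all add: zero)
  have "\<nu> v = \<nu> (\<Sum>k\<in>UNIV. v $ k *\<^sub>R axis k 1)"
    using basis_expansion[of v] by (simp add: scalar_mult_eq_scaleR)
  also have "\<dots> \<le> (\<Sum>k\<in>UNIV. \<bar>v $ k\<bar> * \<nu> (axis k 1))"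
    using tri[of "\<lambda>k. v $ k *\<^sub>R axis k 1" UNIV] assms by (simp add: is_norm_def)
  also have "\<dots> \<le> (\<Sum>k\<in>UNIV. norm v * \<nu> (axis k 1))"
    using assms by (intro sum_mono mult_right_mono component_le_norm_cart) (simp add: is_norm_def)
  finally show ?thesis
    by (simp add: sum_distrib_left mult.commute)
qed

lemma inner_eq_sum_block: "X \<bullet> Y = (\<Sum>i\<in>UNIV. block X i \<bullet> block Y i)"
  by (simp add: inner_vec_def block_def UNIV_Times_UNIV[symmetric] sum.cartesian_product
      del: UNIV_Times_UNIV)

lemma block_kronecker_mat1:
  "block ((A \<otimes>\<^sub>K mat 1) *v Y) i = (\<Sum>j\<in>UNIV. A $ i $ j *\<^sub>R block Y j)"
  for A :: "real^'N^'N" and Y :: "real^('N::finite \<times> 'n::finite)"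
proof -
  have "(\<Sum>s\<in>UNIV. A $ i $ fst s * mat 1 $ k $ snd s * Y $ s) = (\<Sum>j\<in>UNIV. A $ i $ j * Y $ (j, k))"
    for k :: 'n
  proof -
    have "(\<Sum>s\<in>UNIV. A $ i $ fst s * mat 1 $ k $ snd s * Y $ s) =
        (\<Sum>j\<in>UNIV. \<Sum>l\<in>UNIV. A $ i $ j * mat 1 $ k $ l * Y $ (j, l))"
      by (simp add: sum.cartesian_product case_prod_beta)
    also have "\<dots> = (\<Sum>j\<in>UNIV. \<Sum>l\<in>UNIV. if k = l then A $ i $ j * Y $ (j, l) else 0)"
      by (intro sum.cong refl) (simp add: mat_def)
    finally show ?thesis by simp
  qed
  then show ?thesis
    by (simp add: vec_eq_iff block_def kronecker_def matrix_vector_mult_def)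
qed

lemma bounded_linear_block: "bounded_linear (\<lambda>X :: real^('N::finite \<times> 'n::finite). block X i)"
  unfolding linear_conv_bounded_linear[symmetric]
  by (rule linearI) (simp_all add: block_def vec_eq_iff)

text \<open>The diagonal matrix is dominated by the sum of the
  \<open>\<bar>\<delta> $ k\<bar>\<close> times the identity. So crude a constant suffices, because
  the adaptive gain argument works for every \<open>K\<close>.\<close>

lemma QUAD_one_sided_lipschitz:
  fixes f :: "real^'n \<Rightarrow> real \<Rightarrow> real^'n"
  assumes "QUAD (diag_mat \<delta>) \<omega> f" "0 \<le> \<omega>" "0 \<le> t"
  shows "(x - y) \<bullet> (f x t - f y t) \<le> (\<Sum>k\<in>UNIV. \<bar>\<delta> $ k\<bar>) * ((x - y) \<bullet> (x - y))"
proof -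
  define z where "z = x - y"
  have diag: "(diag_mat \<delta> *v z) $ k = \<delta> $ k * z $ k" for k
  proof -
    have "(diag_mat \<delta> *v z) $ k = (\<Sum>l\<in>UNIV. if k = l then \<delta> $ k * z $ l else 0)"
      unfolding diag_mat_def matrix_vector_mult_def vec_lambda_beta by (intro sum.cong) auto
    then show ?thesis by simp
  qed
  have "z \<bullet> (diag_mat \<delta> *v z) = (\<Sum>k\<in>UNIV. \<delta> $ k * (z $ k * z $ k))"
    by (simp add: inner_vec_def diag mult_ac)
  also have "\<dots> \<le> (\<Sum>k\<in>UNIV. (\<Sum>l\<in>UNIV. \<bar>\<delta> $ l\<bar>) * (z $ k * z $ k))"
  proof (intro sum_mono mult_right_mono)
    fix k
    show "\<delta> $ k \<le> (\<Sum>l\<in>UNIV. \<bar>\<delta> $ l\<bar>)"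
      using member_le_sum[of k UNIV "\<lambda>l. \<bar>\<delta> $ l\<bar>"] by simp
  qed simp
  also have "\<dots> = (\<Sum>k\<in>UNIV. \<bar>\<delta> $ k\<bar>) * (z \<bullet> z)"
    by (simp add: inner_vec_def sum_distrib_left[symmetric])
  finally have "z \<bullet> (diag_mat \<delta> *v z) \<le> (\<Sum>k\<in>UNIV. \<bar>\<delta> $ k\<bar>) * (z \<bullet> z)" .
  moreover have "z \<bullet> (f x t - f y t) - z \<bullet> (diag_mat \<delta> *v z) \<le> - \<omega> * (z \<bullet> z)"
    using assms unfolding QUAD_def z_def by blast
  moreover have "- \<omega> * (z \<bullet> z) \<le> 0"
    using \<open>0 \<le> \<omega>\<close> by simp
  ultimately show ?thesis
    unfolding z_def by linarith
qed

section \<open>Synchronization of the network\<close>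

theorem theorem4:
  fixes A :: "real^'N^'N"
    and f :: "real^'n \<Rightarrow> real \<Rightarrow> real^'n"
    and \<delta> :: "real^'n"
    and g :: "'n \<Rightarrow> real \<Rightarrow> real"
    and \<omega> \<beta> \<alpha> :: real
    and \<nu> :: "real^'n \<Rightarrow> real"
  assumes "CARD('N) \<ge> 2"
    and "A2 A" and "irreducible_mat A"
    and "continuous_on (UNIV \<times> {0..}) (\<lambda>(x, t). f x t)"
    and "\<omega> > 0" and "QUAD (diag_mat \<delta>) \<omega> f"
    and "\<beta> > 0" and "\<And>k u v. u \<noteq> v \<Longrightarrow> (g k u - g k v) / (u - v) \<ge> \<beta>"
    and "\<alpha> > 0"
    and "is_norm \<nu>"
  shows "\<forall>X0 X c. adaptive_solution A f g \<alpha> X c \<and> X 0 = X0 \<longrightarrow>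
           (\<forall>i j. ((\<lambda>t. \<nu> (block (X t) i - block (X t) j)) \<longlongrightarrow> 0) at_top)"
proof (intro allI impI, elim conjE)
  fix X0 :: "real^('N \<times> 'n)" and X :: "real \<Rightarrow> real^('N \<times> 'n)" and c :: "real \<Rightarrow> real" and i0 j0 :: 'N
  assume sol: "adaptive_solution A f g \<alpha> X c"
  have nonneg: "0 \<le> A $ i $ j" if "i \<noteq> j" for i j
    using \<open>A2 A\<close> that by (auto simp: A2_def A1_def)
  have sym: "A $ i $ j = A $ j $ i" for i j
    using \<open>A2 A\<close> by (cases "i = j") (auto simp: A2_def)
  have row: "(\<Sum>j\<in>UNIV. A $ i $ j) = 0" for i
  proof -
    have "A $ i $ i = - (\<Sum>j\<in>UNIV - {i}. A $ i $ j)"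
      using \<open>A2 A\<close> by (simp add: A2_def A1_def)
    then show ?thesis
      by (simp add: sum.remove[of UNIV i])
  qed
  obtain m where "0 < m" and gap: "\<And>v :: real^'N. (\<Sum>i\<in>UNIV. v $ i) = 0 \<Longrightarrow>
      m * (v \<bullet> v) \<le> (\<Sum>i\<in>UNIV. \<Sum>j\<in>UNIV. A $ i $ j * (v $ i - v $ j)\<^sup>2)"
    using irreducible_spectral_gap[OF nonneg \<open>irreducible_mat A\<close>] by blast

  \<comment> \<open>\<open>xm\<close> is the mean state. The primed quantities are the derivatives
    dictated by the system, and \<open>S\<close> is the coupling form
    \<open>X t \<bullet> ((A \<otimes>\<^sub>K mat 1) *v G_net g (X t))\<close> multiplied by
    \<open>- 2\<close>, rewritten in differences of nodes.\<close>
  define x where "x i t = block (X t) i" for i t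
  define y where "y i t = (\<chi> k. g k (x i t $ k))" for i t
  define h where "h i t = (\<Sum>j\<in>UNIV. A $ i $ j *\<^sub>R y j t)" for i t
  define xm where "xm t = (1 / real CARD('N)) *\<^sub>R (\<Sum>i\<in>UNIV. x i t)" for t
  define x' where "x' i t = f (x i t) t + c t *\<^sub>R h i t" for i t
  define xm' where "xm' t = (1 / real CARD('N)) *\<^sub>R (\<Sum>i\<in>UNIV. x' i t)" for t
  define W where "W t = (\<Sum>i\<in>UNIV. (x i t - xm t) \<bullet> (x i t - xm t))" for t
  define W' where "W' t = (\<Sum>i\<in>UNIV. 2 * ((x i t - xm t) \<bullet> (x' i t - xm' t)))" for t
  define S where "S t = (\<Sum>i\<in>UNIV. \<Sum>j\<in>UNIV. A $ i $ j * ((x i t - x j t) \<bullet> (y i t - y j t)))" for t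
  define D where "D = (\<Sum>k\<in>UNIV. \<bar>\<delta> $ k\<bar>)"

  have block_G: "block (G_net g (X t)) j = y j t" for j t
    by (simp add: G_net_def stack_def block_def y_def x_def vec_eq_iff)
  have block_coupling: "block ((A \<otimes>\<^sub>K mat 1) *v G_net g (X t)) i = h i t" for i t
    by (simp add: block_kronecker_mat1 block_G h_def)
  have inner_h: "(\<Sum>i\<in>UNIV. x i t \<bullet> h i t) = - S t / 2" for t
    unfolding h_def S_def by (rule laplacian_inner_eq[OF sym row])
  \<comment> \<open>Symmetry turns row sums into column sums, so the coupling exerts no net force on
    the mean.\<close>
  have sum_h: "(\<Sum>i\<in>UNIV. h i t) = 0" for t
  proof -
    have "(\<Sum>i\<in>UNIV. h i t) = (\<Sum>j\<in>UNIV. \<Sum>i\<in>UNIV. A $ j $ i *\<^sub>R y j t)"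
      unfolding h_def by (subst sum.swap, subst sym) (rule refl)
    then show ?thesis
      by (simp add: scaleR_left.sum[symmetric] row)
  qed
  have sum_dev: "(\<Sum>i\<in>UNIV. x i t - xm t) = 0" for t
    by (simp add: sum_subtractf xm_def sum_constant_scaleR del: sum_constant)

  \<comment> \<open>Derivatives along a solution\<close>
  have x_deriv: "(x i has_vector_derivative x' i t) (at t within {0..})" if "0 \<le> t" for i t
  proof -
    have "(X has_vector_derivative
        F_net f t (X t) + c t *\<^sub>R ((A \<otimes>\<^sub>K mat 1) *v G_net g (X t))) (at t within {0..})"
      using sol that by (simp add: adaptive_solution_def)
    from bounded_linear.has_vector_derivative[OF bounded_linear_block this, of i]
    have "(x i has_vector_derivative
        block (F_net f t (X t) + c t *\<^sub>R ((A \<otimes>\<^sub>K mat 1) *v G_net g (X t))) i) (at t within {0..})"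
      by (simp add: x_def[abs_def])
    moreover have "block (F_net f t (X t) + c t *\<^sub>R ((A \<otimes>\<^sub>K mat 1) *v G_net g (X t))) i =
        block (F_net f t (X t)) i + c t *\<^sub>R block ((A \<otimes>\<^sub>K mat 1) *v G_net g (X t)) i"
      by (simp add: block_def vec_eq_iff)
    moreover have "block (F_net f t (X t)) i = f (x i t) t"
      by (simp add: F_net_def stack_def block_def x_def vec_eq_iff)
    ultimately show ?thesis
      by (simp add: block_coupling x'_def)
  qed
  have xm_deriv: "(xm has_vector_derivative xm' t) (at t within {0..})" if "0 \<le> t" for t
    unfolding xm_def[abs_def] xm'_def
    by (intro bounded_linear.has_vector_derivative[OF bounded_linear_scaleR_right]
        has_vector_derivative_sum x_deriv that)
  have W_deriv: "(W has_real_derivative W' t) (at t within {0..})" if "0 \<le> t" for t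
  proof -
    have "((\<lambda>t. (x i t - xm t) \<bullet> (x i t - xm t)) has_real_derivative
        2 * ((x i t - xm t) \<bullet> (x' i t - xm' t))) (at t within {0..})" for i
      using bounded_bilinear.has_vector_derivative[OF bounded_bilinear_inner
          has_vector_derivative_diff[OF x_deriv xm_deriv, OF that that, of i]
          has_vector_derivative_diff[OF x_deriv xm_deriv, OF that that, of i]]
      by (simp add: has_real_derivative_iff_has_vector_derivative inner_commute)
    then show ?thesis
      unfolding W_def[abs_def] W'_def by (intro DERIV_sum)
  qed
  have c_deriv: "(c has_real_derivative \<alpha> / 4 * S t) (at t within {0..})" if "0 \<le> t" for t
  proof -
    have "X t \<bullet> ((A \<otimes>\<^sub>K mat 1) *v G_net g (X t)) = - S t / 2"
      by (simp add: inner_eq_sum_block block_coupling x_def[symmetric] inner_h)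
    moreover have "(c has_real_derivative
        - (\<alpha> / 2) * (X t \<bullet> ((A \<otimes>\<^sub>K mat 1) *v G_net g (X t)))) (at t within {0..})"
      using sol that by (simp add: adaptive_solution_def)
    ultimately show ?thesis by simp
  qed

  \<comment> \<open>Lower bound for the coupling and decay estimate for \<open>W\<close>\<close>
  have S_ge: "\<beta> * m * W t \<le> S t" for t
  proof -
    \<comment> \<open>The spectral gap concerns vectors indexed by nodes, so \<open>W\<close> is
      regrouped by component \<open>k\<close>; the deviations in each component sum to zero.\<close>
    have W_swap: "W t = (\<Sum>k\<in>UNIV. (\<chi> i. (x i t - xm t) $ k) \<bullet> (\<chi> i. (x i t - xm t) $ k))"
      unfolding W_def inner_vec_def by (subst sum.swap) simp
    have "m * W t \<le> (\<Sum>k\<in>UNIV. \<Sum>i\<in>UNIV. \<Sum>j\<in>UNIV. A $ i $ j * (x i t $ k - x j t $ k)\<^sup>2)"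
      unfolding W_swap sum_distrib_left
    proof (rule sum_mono)
      fix k
      have "(\<Sum>i\<in>UNIV. (\<chi> i. (x i t - xm t) $ k) $ i) = 0"
        using arg_cong[OF sum_dev[of t], of "\<lambda>v. v $ k"] by (simp add: sum_component)
      from gap[OF this]
      show "m * ((\<chi> i. (x i t - xm t) $ k) \<bullet> (\<chi> i. (x i t - xm t) $ k)) \<le>
          (\<Sum>i\<in>UNIV. \<Sum>j\<in>UNIV. A $ i $ j * (x i t $ k - x j t $ k)\<^sup>2)"
        by simp
    qed
    also have "\<dots> = (\<Sum>i\<in>UNIV. \<Sum>j\<in>UNIV. A $ i $ j * (\<Sum>k\<in>UNIV. (x i t $ k - x j t $ k)\<^sup>2))"
      unfolding sum_distrib_left by (subst sum.swap) (intro sum.cong refl sum.swap)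
    finally have "\<beta> * (m * W t) \<le> \<beta> * \<dots>"
      using \<open>\<beta> > 0\<close> by simp
    also have "\<dots> = (\<Sum>i\<in>UNIV. \<Sum>j\<in>UNIV. A $ i $ j * (\<Sum>k\<in>UNIV. \<beta> * (x i t $ k - x j t $ k)\<^sup>2))"
      by (simp add: sum_distrib_left mult_ac)
    also have "\<dots> \<le> S t"
      unfolding S_def
    proof (intro sum_mono)
      fix i j
      have g_mono: "\<beta> * (u - v)\<^sup>2 \<le> (u - v) * (g k u - g k v)" for k u v
      proof (cases "u = v")
        case False
        then have "\<beta> * (u - v)\<^sup>2 \<le> (g k u - g k v) / (u - v) * (u - v)\<^sup>2"
          using assms(8) by (intro mult_right_mono) auto
        with False show ?thesis
          by (simp add: power2_eq_square mult.commute)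
      qed simp
      have "(\<Sum>k\<in>UNIV. \<beta> * (x i t $ k - x j t $ k)\<^sup>2) \<le> (x i t - x j t) \<bullet> (y i t - y j t)"
        unfolding inner_vec_def y_def by (intro sum_mono) (simp add: g_mono)
      \<comment> \<open>For \<open>i = j\<close> both sides are 0, so the sign of the diagonal entry
        does not matter.\<close>
      then show "A $ i $ j * (\<Sum>k\<in>UNIV. \<beta> * (x i t $ k - x j t $ k)\<^sup>2) \<le>
          A $ i $ j * ((x i t - x j t) \<bullet> (y i t - y j t))"
        using nonneg[of i j] by (cases "i = j") (auto intro: mult_left_mono)
    qed
    finally show ?thesis by (simp add: mult.assoc)
  qed

  have W'_le: "W' t \<le> 2 * D * W t - c t * S t" if "0 \<le> t" for t
  proof -
    \<comment> \<open>Adding and subtracting \<open>f (xm t) t\<close> leaves terms independent of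
      \<open>i\<close>; they are paired with the sum of the deviations, which is 0.\<close>
    have "(\<Sum>i\<in>UNIV. (x i t - xm t) \<bullet> (x' i t - xm' t)) =
        (\<Sum>i\<in>UNIV. (x i t - xm t) \<bullet> (f (x i t) t - f (xm t) t))
        + (\<Sum>i\<in>UNIV. x i t - xm t) \<bullet> (f (xm t) t - xm' t)
        + c t * ((\<Sum>i\<in>UNIV. x i t \<bullet> h i t) - xm t \<bullet> (\<Sum>i\<in>UNIV. h i t))"
      unfolding inner_sum_left inner_sum_right sum_subtractf[symmetric] sum_distrib_left
        sum.distrib[symmetric] x'_def
      by (intro sum.cong refl) (simp add: algebra_simps)
    also have "\<dots> = (\<Sum>i\<in>UNIV. (x i t - xm t) \<bullet> (f (x i t) t - f (xm t) t)) - c t * S t / 2"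
      by (simp add: sum_dev sum_h inner_h)
    also have "(\<Sum>i\<in>UNIV. (x i t - xm t) \<bullet> (f (x i t) t - f (xm t) t)) \<le> D * W t"
      unfolding W_def D_def sum_distrib_left
      using QUAD_one_sided_lipschitz[OF assms(6) _ that] \<open>\<omega> > 0\<close> by (intro sum_mono) auto
    finally show ?thesis
      by (simp add: W'_def sum_distrib_left[symmetric])
  qed

  \<comment> \<open>Convergence to the mean and in the given norm\<close>
  have W_zero: "(W \<longlongrightarrow> 0) at_top"
  proof (rule adaptive_gain_tendsto_zero[OF W_deriv c_deriv])
    show "0 \<le> W t" for t
      unfolding W_def by (intro sum_nonneg) simp
    show "0 \<le> c 0"
      using sol by (simp add: adaptive_solution_def)
    \<comment> \<open>As \<open>c'\<close> is \<open>\<alpha> / 4 * S t\<close>, the choice of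
      \<open>4 / \<alpha>\<close> for \<open>\<gamma>\<close> makes
      \<open>\<gamma> * c t * c' t\<close> equal to \<open>c t * S t\<close>; the bound on
      \<open>S\<close> gives \<open>\<kappa>\<close>, and \<open>K\<close> is
      \<open>2 * D\<close>.\<close>
    show "0 < \<alpha> / 4 * (\<beta> * m)" "0 < 4 / \<alpha>"
      using \<open>\<alpha> > 0\<close> \<open>\<beta> > 0\<close> \<open>0 < m\<close> by simp_all
    show "\<alpha> / 4 * (\<beta> * m) * W t \<le> \<alpha> / 4 * S t" for t
      using S_ge[of t] \<open>\<alpha> > 0\<close> by (simp add: mult.assoc)
    show "W' t \<le> 2 * D * W t - 4 / \<alpha> * c t * (\<alpha> / 4 * S t)" if "0 \<le> t" for t
      using W'_le[OF that] \<open>\<alpha> > 0\<close> by simp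
  qed
  define C where "C = (\<Sum>k\<in>UNIV. \<nu> (axis k 1))"
  have "0 \<le> C"
    using \<open>is_norm \<nu>\<close> by (auto simp: C_def is_norm_def intro: sum_nonneg)
  have dev: "norm (x i t - xm t) \<le> sqrt (W t)" for i t
    unfolding norm_eq_sqrt_inner W_def real_sqrt_le_iff
    by (rule member_le_sum[of i UNIV "\<lambda>i. (x i t - xm t) \<bullet> (x i t - xm t)"]) auto
  \<comment> \<open>The factor 2 comes from comparing both nodes with the mean, each at distance at
    most \<open>sqrt (W t)\<close>.\<close>
  have bound: "\<nu> (x i0 t - x j0 t) \<le> C * (2 * sqrt (W t))" for t
  proof -
    have "norm (x i0 t - x j0 t) \<le> norm (x i0 t - xm t) + norm (x j0 t - xm t)"
      using norm_triangle_ineq4[of "x i0 t - xm t" "x j0 t - xm t"] by simp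
    then have "norm (x i0 t - x j0 t) \<le> 2 * sqrt (W t)"
      using dev[of i0 t] dev[of j0 t] by simp
    from mult_left_mono[OF this \<open>0 \<le> C\<close>] is_norm_le_norm[OF \<open>is_norm \<nu>\<close>, of "x i0 t - x j0 t"]
    show ?thesis by (simp add: C_def)
  qed
  have lim: "((\<lambda>t. C * (2 * sqrt (W t))) \<longlongrightarrow> 0) at_top"
    using tendsto_mult_right_zero[OF tendsto_mult_right_zero[OF
      tendsto_real_sqrt[OF W_zero, simplified]]] .
  have nu_nonneg: "0 \<le> \<nu> (x i0 t - x j0 t)" for t
    using \<open>is_norm \<nu>\<close> by (simp add: is_norm_def)
  show "((\<lambda>t. \<nu> (block (X t) i0 - block (X t) j0)) \<longlongrightarrow> 0) at_top"
    unfolding x_def[symmetric]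
    by (rule tendsto_sandwich[OF _ _ tendsto_const lim]) (simp_all add: bound nu_nonneg)
qed

end
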